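(* For all integers $k, n$ with $2\leq k\leq n$, we have $$|S_n^{(k)}(123)|=|S_n^{(k)}(321)|=2^{n-k+1}+k-2.$$
   Context: $S_n$ denotes the set of permutations $p=p(1)p(2)\cdots p(n)$ of $\{1,2,\ldots,n\}$ in one-line notation. For $p\in S_n$ and $q\in S_m$, $p$ contains $q$ as a pattern if there exist $1\leq i_1<\cdots<i_m\leq n$ such that for all $1\leq a<b\leq m$, $p(i_a)<p(i_b)$ if and only if $q(a)<q(b)$; otherwise $p$ avoids $q$. The rotations of $p\in S_n$ are $p^{(1)}=p$ and, for $i\in\{2,\ldots,n\}$, $p^{(i)}=p(i)p(i+1)\cdots p(n)p(1)p(2)\cdots p(i-1)$. For a pattern $q$, $S_n^{(k)}(q)$ is the set of $p\in S_n$ such that $p^{(i)}$ avoids $q$ for all $i\in\{1,2,\ldots,k\}$. *)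

theory Defs
  imports Main "HOL-Combinatorics.Multiset_Permutations"
begin

text \<open>
  A permutation in $S_n$ is represented by its one-line notation: a list in
  \<open>permutations_of_set {1..n}\<close>. Values are 1-based as usual, but list positions
  are 0-based, so $p(j)$ is \<open>p ! (j - 1)\<close>.
\<close>

definition contains_pattern :: "nat list \<Rightarrow> nat list \<Rightarrow> bool" where
  "contains_pattern p q \<longleftrightarrow>
     (\<exists>f :: nat \<Rightarrow> nat. strict_mono_on {..<length q} f \<and>
        f ` {..<length q} \<subseteq> {..<length p} \<and>
        (\<forall>a b. a < b \<and> b < length q \<longrightarrow> (p ! f a < p ! f b \<longleftrightarrow> q ! a < q ! b)))"

definition avoids_pattern :: "nat list \<Rightarrow> nat list \<Rightarrow> bool" where
  "avoids_pattern p q \<longleftrightarrow> \<not> contains_pattern p q"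

text \<open>\<open>rotation i p\<close>, for \<open>1 \<le> i \<le> n\<close>, is $p^{(i)}$, which starts at the entry $p(i)$.\<close>

definition rotation :: "nat \<Rightarrow> nat list \<Rightarrow> nat list" where
  "rotation i p = rotate (i - 1) p"

text \<open>\<open>rot_avoiders n k q\<close> is $S_n^{(k)}(q)$.\<close>

definition rot_avoiders :: "nat \<Rightarrow> nat \<Rightarrow> nat list \<Rightarrow> nat list set" where
  "rot_avoiders n k q =
     {p \<in> permutations_of_set {1..n}. \<forall>i\<in>{1..k}. avoids_pattern (rotation i p) q}"

end

theory Submission
  imports Defs
begin

text \<open>
  Put \<open>m = k - 1\<close>. Complementing values exchanges the two patterns, so consider 321.
  Seen in the unrotated permutation \<open>p\<close>, a 321 in one of the first \<open>k\<close> rotations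
  is a 321, a 132 whose first entry is among the first \<open>m\<close>, or a 213 whose first two
  entries are among the first \<open>m\<close>. With \<open>v = p(1)\<close>, avoiding 321 and 132 makes the
  values below \<open>v\<close> and those above \<open>v\<close> increase. If \<open>p\<close> starts with
  \<open>v, v+1, ..., v+m-1\<close>, the remaining entries are an arbitrary shuffle of the smaller and
  larger values, which gives \<open>2 ^ (n - m)\<close> permutations in total. Otherwise a value below
  \<open>v\<close> occurs among the first \<open>m\<close> entries; avoiding 213, no larger value may follow it,
  so \<open>p\<close> is one of \<open>m - 1\<close> rotations of the identity.
\<close>

section \<open>Pattern triples and complementation\<close>

lemma contains_321_iff:
  assumes "distinct p"
  shows "contains_pattern p [3, 2, 1] \<longleftrightarrow>
    (\<exists>i j l. i < j \<and> j < l \<and> l < length p \<and> p ! j < p ! i \<and> p ! l < p ! j)"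
    (is "?L \<longleftrightarrow> ?R")
proof
  assume ?L
  then obtain f where f: "strict_mono_on {..<3} f" "f ` {..<3} \<subseteq> {..<length p}"
    and o: "\<And>a b. a < b \<Longrightarrow> b < 3 \<Longrightarrow> p ! f a < p ! f b \<longleftrightarrow> [3, 2, 1::nat] ! a < [3, 2, 1] ! b"
    by (auto simp: contains_pattern_def numeral_3_eq_3)
  have "f 0 < f 1" "f 1 < f 2" "f 2 < length p"
    using f by (auto simp: strict_mono_on_def image_subset_iff)
  moreover have "\<not> p ! f 0 < p ! f 1" "\<not> p ! f 1 < p ! f 2"
    using o[of 0 1] o[of 1 2] by auto
  \<comment> \<open>The pattern condition only denies \<open><\<close>; distinctness turns that into
    strict descents.\<close>
  moreover have "p ! f 0 \<noteq> p ! f 1" "p ! f 1 \<noteq> p ! f 2"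
    using calculation assms by (auto simp: nth_eq_iff_index_eq)
  ultimately show ?R by (metis linorder_neqE_nat)
next
  assume ?R
  then obtain i j l where "i < j" "j < l" "l < length p" "p ! j < p ! i" "p ! l < p ! j"
    by blast
  then show ?L
    unfolding contains_pattern_def
    by (intro exI[of _ "\<lambda>a. [i, j, l] ! a"])
       (auto simp: strict_mono_on_def less_Suc_eq)
qed

lemma contains_123_iff:
  "contains_pattern p [1, 2, 3] \<longleftrightarrow>
    (\<exists>i j l. i < j \<and> j < l \<and> l < length p \<and> p ! i < p ! j \<and> p ! j < p ! l)"
    (is "?L \<longleftrightarrow> ?R")
proof
  assume ?L
  then obtain f where f: "strict_mono_on {..<3} f" "f ` {..<3} \<subseteq> {..<length p}"
    and o: "\<And>a b. a < b \<Longrightarrow> b < 3 \<Longrightarrow> p ! f a < p ! f b \<longleftrightarrow> [1, 2, 3::nat] ! a < [1, 2, 3] ! b"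
    by (auto simp: contains_pattern_def numeral_3_eq_3)
  have "f 0 < f 1" "f 1 < f 2" "f 2 < length p"
    using f by (auto simp: strict_mono_on_def image_subset_iff)
  moreover have "p ! f 0 < p ! f 1" "p ! f 1 < p ! f 2"
    using o[of 0 1] o[of 1 2] by auto
  ultimately show ?R by blast
next
  assume ?R
  then obtain i j l where "i < j" "j < l" "l < length p" "p ! i < p ! j" "p ! j < p ! l"
    by blast
  then show ?L
    unfolding contains_pattern_def
    by (intro exI[of _ "\<lambda>a. [i, j, l] ! a"])
       (auto simp: strict_mono_on_def less_Suc_eq)
qed

lemma contains_123_iff_complement_321:
  assumes "p \<in> permutations_of_set {1..n}"
  shows "contains_pattern p [1, 2, 3] \<longleftrightarrow> contains_pattern (map (\<lambda>x. Suc n - x) p) [3, 2, 1]"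
proof -
  have p: "set p = {1..n}" "distinct p"
    using assms by (auto dest: permutations_of_setD)
  have d: "distinct (map (\<lambda>x. Suc n - x) p)"
    using p by (auto simp: distinct_map inj_on_def)
  \<comment> \<open>Truncated subtraction reverses the order only on values up to
    \<open>Suc n\<close>, hence this bound on the entries.\<close>
  have "p ! i \<le> n" if "i < length p" for i
    using that p nth_mem[of i p] by auto
  then have "Suc n - p ! i < Suc n - p ! j \<longleftrightarrow> p ! j < p ! i" if "i < length p" "j < length p" for i j
    using that by (metis diff_less_mono2 le_imp_less_Suc less_diff_conv2 linorder_not_less
        nat_less_le not_less_iff_gr_or_eq)
  then show ?thesis
    unfolding contains_123_iff contains_321_iff[OF d]
    by (intro ex_cong1) auto
qed

text \<open>Complementing values is an involution that commutes with rotation and turns 123 into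
  321, so it restricts to a bijection.\<close>

lemma card_rot_avoiders_123_eq_321:
  "card (rot_avoiders n k [1, 2, 3]) = card (rot_avoiders n k [3, 2, 1])"
proof (rule bij_betw_same_card)
  let ?c = "map (\<lambda>x. Suc n - x)"
  have inv: "?c (?c p) = p" if "set p = {1..n}" for p
    using that by (auto intro!: map_idI)
  have perm: "?c p \<in> permutations_of_set {1..n}" if "p \<in> permutations_of_set {1..n}" for p
  proof -
    have p: "set p = {1..n}" "distinct p"
      using that by (auto dest: permutations_of_setD)
    have "(\<lambda>x. Suc n - x) ` {1..n} = {1..n}"
    proof (intro equalityI subsetI)
      fix x assume "x \<in> {1..n}"
      then show "x \<in> (\<lambda>x. Suc n - x) ` {1..n}"
        by (intro image_eqI[of _ _ "Suc n - x"]) auto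
    qed auto
    then show ?thesis
      using p by (auto simp: permutations_of_set_def distinct_map inj_on_def)
  qed
  have rot: "rotation i p \<in> permutations_of_set {1..n}" if "p \<in> permutations_of_set {1..n}" for i p
    using that by (auto simp: rotation_def permutations_of_set_def)
  have iff: "avoids_pattern (rotation i p) [1, 2, 3] \<longleftrightarrow> avoids_pattern (rotation i (?c p)) [3, 2, 1]"
    if "p \<in> permutations_of_set {1..n}" for i p
    using contains_123_iff_complement_321[OF rot[OF that]]
    by (simp add: avoids_pattern_def rotation_def rotate_map)
  show "bij_betw ?c (rot_avoiders n k [1, 2, 3]) (rot_avoiders n k [3, 2, 1])"
  proof (rule bij_betw_byWitness[where f' = ?c])
    show "?c ` rot_avoiders n k [1, 2, 3] \<subseteq> rot_avoiders n k [3, 2, 1]"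
      using iff perm by (auto simp: rot_avoiders_def)
    show "?c ` rot_avoiders n k [3, 2, 1] \<subseteq> rot_avoiders n k [1, 2, 3]"
      using iff perm inv
      by (auto simp: rot_avoiders_def permutations_of_setD simp del: map_map)
  qed (auto simp: rot_avoiders_def inv permutations_of_setD simp del: map_map)
qed

section \<open>Rotated 321 patterns as conditions on \<open>p\<close>\<close>

text \<open>
  The second and third conditions exclude triples that read 321 after rotating the first
  one, respectively two, of their entries to the end. Positions are 0-based, hence \<open>< m\<close>.
\<close>

definition cyclically_321_free :: "nat \<Rightarrow> nat list \<Rightarrow> bool" where
  "cyclically_321_free m p \<longleftrightarrow> (\<forall>i j l. i < j \<and> j < l \<and> l < length p \<longrightarrow>
     \<not> (p ! l < p ! j \<and> p ! j < p ! i) \<and>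
     (i < m \<longrightarrow> \<not> (p ! i < p ! l \<and> p ! l < p ! j)) \<and>
     (j < m \<longrightarrow> \<not> (p ! j < p ! i \<and> p ! i < p ! l)))"

lemma nth_rotate_if:
  assumes "r < length p" "a < length p"
  shows "rotate r p ! a = (if a + r < length p then p ! (a + r) else p ! (a + r - length p))"
  using assms by (auto simp: nth_rotate add.commute mod_if)

text \<open>Rotation by \<open>r\<close> moves exactly the first \<open>r\<close> positions to the
  end. A triple \<open>i < j < l\<close> is thus read as \<open>j, l, i\<close> when
  \<open>i < r <= j\<close> and as \<open>l, i, j\<close> when \<open>j < r <= l\<close>, where
  \<open>r\<close> runs from 0 to \<open>m\<close>.\<close>

lemma rot_avoiders_321_iff:
  assumes "p \<in> permutations_of_set {1..n}" "m < n"
  shows "p \<in> rot_avoiders n (Suc m) [3, 2, 1] \<longleftrightarrow> cyclically_321_free m p"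
proof -
  have len: "length p = n" and dist: "distinct p"
    using assms length_finite_permutations_of_set[OF assms(1)] by (auto dest: permutations_of_setD)
  have "(\<forall>i\<in>{1..Suc m}. P (i - 1)) \<longleftrightarrow> (\<forall>r\<le>m. P r)" for P :: "nat \<Rightarrow> bool"
    by (metis Suc_le_mono atLeastAtMost_iff diff_Suc_1 le_add1 le_add_diff_inverse plus_1_eq_Suc)
  from this[of "\<lambda>r. avoids_pattern (rotate r p) [3, 2, 1]"]
  have *: "p \<in> rot_avoiders n (Suc m) [3, 2, 1] \<longleftrightarrow>
    (\<forall>r\<le>m. \<forall>a b c. a < b \<and> b < c \<and> c < n \<longrightarrow>
       \<not> (rotate r p ! b < rotate r p ! a \<and> rotate r p ! c < rotate r p ! b))" (is "_ \<longleftrightarrow> ?Q")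
    using assms(1) dist len
    by (simp add: rot_avoiders_def rotation_def avoids_pattern_def contains_321_iff
        del: One_nat_def) blast
  show ?thesis unfolding *
  proof
    assume Q: ?Q
    have Q': "\<not> (rotate r p ! b < rotate r p ! a \<and> rotate r p ! c < rotate r p ! b)"
      if "r \<le> m" "a < b" "b < c" "c < n" for r a b c
      using Q that by blast
    show "cyclically_321_free m p" unfolding cyclically_321_free_def
    proof (intro allI impI)
      fix i j l assume A: "i < j \<and> j < l \<and> l < length p"
      have "\<not> (p ! l < p ! j \<and> p ! j < p ! i)"
        using Q'[of 0 i j l] A len by auto
      moreover have "j - Suc i < l - Suc i" "l - Suc i < n - 1" "l - Suc j < i + n - Suc j"
        "i + n - Suc j < n - 1"
        using A len by linarith+
      \<comment> \<open>\<open>Suc i\<close> is the least rotation that wraps position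
        \<open>i\<close>, which then lands at \<open>n - 1\<close>; it is allowed because
        \<open>i < m\<close>. Likewise \<open>Suc j\<close> below.\<close>
      moreover from this have "\<not> (p ! i < p ! l \<and> p ! l < p ! j)" if "i < m"
        using Q'[of "Suc i" "j - Suc i" "l - Suc i" "n - 1"] A len that assms(2)
        by (auto simp: nth_rotate_if simp del: rotate_Suc)
      moreover from calculation have "\<not> (p ! j < p ! i \<and> p ! i < p ! l)" if "j < m"
        using Q'[of "Suc j" "l - Suc j" "i + n - Suc j" "n - 1"] A len that assms(2)
        by (auto simp: nth_rotate_if simp del: rotate_Suc)
      ultimately show "\<not> (p ! l < p ! j \<and> p ! j < p ! i) \<and>
         (i < m \<longrightarrow> \<not> (p ! i < p ! l \<and> p ! l < p ! j)) \<and>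
         (j < m \<longrightarrow> \<not> (p ! j < p ! i \<and> p ! i < p ! l))"
        by blast
    qed
  next
    assume C: "cyclically_321_free m p"
    have C': "\<not> (p ! l < p ! j \<and> p ! j < p ! i)"
      "i < m \<Longrightarrow> \<not> (p ! i < p ! l \<and> p ! l < p ! j)"
      "j < m \<Longrightarrow> \<not> (p ! j < p ! i \<and> p ! i < p ! l)"
      if "i < j" "j < l" "l < n" for i j l
      using C that len unfolding cyclically_321_free_def by blast+
    show ?Q
    proof (intro allI impI)
      fix r a b c assume r: "r \<le> m" and A: "a < b \<and> b < c \<and> c < n"
      \<comment> \<open>The cases count the wrapped entries: none, one, two or all three. Wrapped
        entries come from positions of \<open>p\<close> below \<open>r <= m\<close> and precede the
        others there.\<close>
      consider "c + r < n" | "b + r < n" "n \<le> c + r" | "a + r < n" "n \<le> b + r" | "n \<le> a + r"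
        by linarith
      then show "\<not> (rotate r p ! b < rotate r p ! a \<and> rotate r p ! c < rotate r p ! b)"
      proof cases
        case 1
        then show ?thesis using C'(1)[of "a + r" "b + r" "c + r"] A r len assms(2)
          by (auto simp: nth_rotate_if simp del: rotate_Suc)
      next
        case 2
        then have "c + r - n < r" using A by linarith
        with 2 show ?thesis using C'(2)[of "c + r - n" "a + r" "b + r"] A r len assms(2)
          by (auto simp: nth_rotate_if simp del: rotate_Suc)
      next
        case 3
        then have "b + r - n < c + r - n" "c + r - n < r" using A by linarith+
        with 3 show ?thesis using C'(3)[of "b + r - n" "c + r - n" "a + r"] A r len assms(2)
          by (auto simp: nth_rotate_if simp del: rotate_Suc)
      next
        case 4
        then have "a + r - n < b + r - n" "b + r - n < c + r - n" "c + r - n < n"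
          using A r assms(2) by linarith+
        with 4 show ?thesis using C'(1)[of "a + r - n" "b + r - n" "c + r - n"] A r len assms(2)
          by (auto simp: nth_rotate_if simp del: rotate_Suc)
      qed
    qed
  qed
qed

section \<open>Structure relative to the first entry\<close>

definition inc_sides :: "nat \<Rightarrow> nat list \<Rightarrow> bool" where
  "inc_sides v p \<longleftrightarrow> sorted_wrt (\<lambda>x y. (x < v \<longleftrightarrow> y < v) \<longrightarrow> x < y) p"

lemma inc_sides_nth:
  "inc_sides v p \<longleftrightarrow>
    (\<forall>i j. i < j \<longrightarrow> j < length p \<longrightarrow> (p ! i < v \<longleftrightarrow> p ! j < v) \<longrightarrow> p ! i < p ! j)"
  by (auto simp: inc_sides_def sorted_wrt_iff_nth_less)

text \<open>Each side is increasing with a known set of values, hence fully determined; only the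
  interleaving of the two sides remains free.\<close>

lemma filter_perm_inc_sides:
  assumes "p \<in> permutations_of_set {1..n}" "inc_sides v p" "1 \<le> v" "v \<le> Suc n"
  shows "filter (\<lambda>x. x < v) p = [1..<v]" "filter (\<lambda>x. \<not> x < v) p = [v..<Suc n]"
proof -
  have "sorted_wrt (<) (filter (\<lambda>x. x < v) p)" "sorted_wrt (<) (filter (\<lambda>x. \<not> x < v) p)"
    by (rule sorted_wrt_mono_rel[OF _ sorted_wrt_filter[OF assms(2)[unfolded inc_sides_def]]];
        simp)+
  moreover have "set p = {1..n}"
    using assms(1) by (rule permutations_of_setD)
  ultimately show "filter (\<lambda>x. x < v) p = [1..<v]" "filter (\<lambda>x. \<not> x < v) p = [v..<Suc n]"
    using assms(3,4) by (auto intro!: strict_sorted_equal simp del: upt_Suc)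
qed

lemma cyclically_321_free_cases:
  assumes p: "p \<in> permutations_of_set {1..n}" and m: "1 \<le> m" "m < n"
    and C: "cyclically_321_free m p"
  shows "(\<exists>v\<in>{1..Suc n - m}. \<exists>s \<in> shuffles [1..<v] [v + m..<Suc n]. p = [v..<v + m] @ s) \<or>
         (\<exists>v\<in>{Suc n - m<..n}. p = [v..<Suc n] @ [1..<v])"
proof -
  have len: "length p = n" and dist: "distinct p" and setp: "set p = {1..n}"
    using p length_finite_permutations_of_set[OF p] by (auto dest: permutations_of_setD)
  define v where "v = p ! 0"
  have v: "1 \<le> v" "v \<le> n"
    using setp nth_mem[of 0 p] len m by (auto simp: v_def)
  have ne: "p ! i \<noteq> p ! j" if "i < j" "j < n" for i j
    using that dist len by (simp add: nth_eq_iff_index_eq)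
  have inc: "inc_sides v p"
    unfolding inc_sides_nth
  proof (intro allI impI)
    fix i j assume ij: "i < j" "j < length p" "p ! i < v \<longleftrightarrow> p ! j < v"
    show "p ! i < p ! j"
    proof (cases "i = 0")
      case True
      then show ?thesis using ij ne[of i j] len by (auto simp: v_def)
    next
      case False
      \<comment> \<open>With position 0 as first entry, the 321 condition forbids descents below
        \<open>v\<close>; the 132 condition, available since \<open>0 < m\<close>, forbids them
        above \<open>v\<close>.\<close>
      then have "\<not> (p ! j < p ! i \<and> p ! i < p ! 0)" "\<not> (p ! 0 < p ! j \<and> p ! j < p ! i)"
        using C m ij unfolding cyclically_321_free_def by auto
      then show ?thesis using ij ne[of 0 i] ne[of 0 j] ne[of i j] False len
        unfolding v_def by force
    qed
  qed
  note filt = filter_perm_inc_sides[OF p inc v(1)]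
  have lo: "filter (\<lambda>x. x < v) p = [1..<v]" and hi: "filter (\<lambda>x. \<not> x < v) p = [v..<Suc n]"
    using filt v by auto
  have upt_split: "[v..<Suc n] = [v..<v + j] @ [v + j..<Suc n]"
    if "take j p = [v..<v + j]" "j \<le> n" for j
  proof -
    \<comment> \<open>For \<open>j > 0\<close> the run ends with the value \<open>v + j - 1\<close>,
      which occurs in \<open>p\<close> and so is at most \<open>n\<close>.\<close>
    have "v + j \<le> Suc n"
    proof (cases j)
      case (Suc j')
      then have "v + j' \<in> set (take j p)" using that(1) by simp
      then show ?thesis using setp Suc set_take_subset[of j p] by auto
    qed (use v in auto)
    then show ?thesis by (metis le_add1 le_Suc_ex upt_add_eq_append)
  qed
  have rest: "filter (\<lambda>x. x < v) (drop j p) = [1..<v]" (is ?lo)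
    "filter (\<lambda>x. \<not> x < v) (drop j p) = [v + j..<Suc n]" (is ?hi)
    if "take j p = [v..<v + j]" "j \<le> n" for j
  proof -
    have split: "p = [v..<v + j] @ drop j p"
      using that by (metis append_take_drop_id)
    have "filter (\<lambda>x. x < v) [v..<v + j] = []" "filter (\<lambda>x. \<not> x < v) [v..<v + j] = [v..<v + j]"
      by (auto simp: filter_empty_conv filter_id_conv)
    then show ?lo ?hi
      using lo hi split upt_split[OF that] by (metis append_Nil filter_append, metis filter_append same_append_eq)
  qed
  show ?thesis
  proof (cases "take m p = [v..<v + m]")
    case True
    have "v + m \<le> Suc n"
    proof -
      have "v + (m - 1) \<in> set (take m p)" using True m by auto
      then have "v + (m - 1) \<in> set p" by (rule in_set_takeD)
      then show ?thesis using setp m by auto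
    qed
    moreover have "drop m p \<in> shuffles [1..<v] [v + m..<Suc n]"
      using partition_in_shuffles[of "drop m p" "\<lambda>x. x < v"] rest[OF True] m by simp
    moreover have "p = [v..<v + m] @ drop m p"
      using True by (metis append_take_drop_id)
    ultimately show ?thesis using v by fastforce
  next
    case False
    \<comment> \<open>\<open>j\<close> is the 0-based position of the first entry that breaks the
      run \<open>v, v + 1, ...\<close>.\<close>
    define j where "j = (LEAST j. take (Suc j) p \<noteq> [v..<v + Suc j])"
    have ex: "take (Suc (m - 1)) p \<noteq> [v..<v + Suc (m - 1)]" using False m by simp
    have j1: "take (Suc j) p \<noteq> [v..<v + Suc j]"
      unfolding j_def by (rule LeastI, rule ex)
    have "j \<le> m - 1" unfolding j_def by (rule Least_le, rule ex)
    then have jm: "j < m" "j < n" using m by auto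
    have tk: "take j p = [v..<v + j]"
    proof (cases j)
      case (Suc j')
      then show ?thesis using not_less_Least[of j' "\<lambda>j. take (Suc j) p \<noteq> [v..<v + Suc j]"]
        unfolding j_def[symmetric] by auto
    qed simp
    have pj: "p ! j \<noteq> v + j"
      using j1 tk jm len by (auto simp: take_Suc_conv_app_nth)
    then have j0: "0 < j" by (cases j) (auto simp: v_def)
    have dr: "drop j p = p ! j # drop (Suc j) p"
      using jm len by (simp add: Cons_nth_drop_Suc)
    \<comment> \<open>Otherwise \<open>p ! j\<close> would be the next large value in increasing
      order, namely \<open>v + j\<close>, and the run would go on.\<close>
    have pjv: "p ! j < v"
    proof (rule ccontr)
      assume "\<not> p ! j < v"
      then have "p ! j # filter (\<lambda>x. \<not> x < v) (drop (Suc j) p) = [v + j..<Suc n]"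
        using rest(2)[OF tk] jm dr by simp
      then show False using pj by (metis list.inject list.simps(3) upt_eq_Cons_conv)
    qed
    have pj1: "p ! (j - 1) = v + (j - 1)"
    proof -
      have "p ! (j - 1) = take j p ! (j - 1)" using j0 by simp
      also have "\<dots> = v + (j - 1)" unfolding tk using j0 by simp
      finally show ?thesis .
    qed
    \<comment> \<open>A later value from \<open>v\<close> on would be at least \<open>v + j\<close>
      and form a 213 with the entries at \<open>j - 1\<close> and \<open>j\<close>, which is
      forbidden since \<open>j < m\<close>.\<close>
    have small: "x < v" if "x \<in> set (drop j p)" for x
    proof (rule ccontr)
      assume "\<not> x < v"
      then have "x \<in> set (filter (\<lambda>x. \<not> x < v) (drop j p))" using that by simp
      then have x: "v + j \<le> x" using rest(2)[OF tk] jm by auto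
      then have "x \<noteq> p ! j" using pjv by auto
      then have "x \<in> set (drop (Suc j) p)" using that dr by simp
      then obtain t where t: "t < n - Suc j" "x = p ! (Suc j + t)"
        using len jm by (auto simp: in_set_conv_nth)
      have "\<not> (p ! j < p ! (j - 1) \<and> p ! (j - 1) < p ! (Suc j + t))"
        using C[unfolded cyclically_321_free_def, rule_format, of "j - 1" j "Suc j + t"] j0 jm t(1) len
        by auto
      then show False using pj1 pjv x t j0 by auto
    qed
    then have "filter (\<lambda>x. x < v) (drop j p) = drop j p"
      "filter (\<lambda>x. \<not> x < v) (drop j p) = []"
      by (auto simp: filter_id_conv filter_empty_conv)
    then have d: "drop j p = [1..<v]" and "[v + j..<Suc n] = []"
      using rest[OF tk] jm by auto
    \<comment> \<open>The run has used up all values from \<open>v\<close> to \<open>n\<close>. Then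
      \<open>v + j = Suc n\<close> and \<open>j < m\<close> place \<open>v\<close> above
      \<open>Suc n - m\<close>.\<close>
    then have "Suc n \<le> v + j" by (auto split: if_splits)
    moreover have "v + j \<le> Suc n"
      using d len jm v by (metis One_nat_def Suc_diff_1 Suc_leI add_Suc_right diff_Suc_1 le_add_diff_inverse2 length_drop length_upt less_imp_le_nat order_refl zero_less_one add.commute)
    ultimately have vj: "v + j = Suc n" by simp
    then have "p = [v..<Suc n] @ [1..<v]"
      using d tk by (metis append_take_drop_id)
    then show ?thesis using vj jm v by auto
  qed
qed

text \<open>Two entries on the same side of \<open>v\<close> come from the same list, whose order a
  shuffle preserves.\<close>

lemma inc_sides_shuffles:
  assumes "zs \<in> shuffles xs ys" "sorted_wrt (<) xs" "sorted_wrt (<) ys"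
    and "\<forall>x\<in>set xs. x < v" "\<forall>y\<in>set ys. v \<le> y"
  shows "inc_sides v zs"
  using assms
proof (induction xs ys arbitrary: zs rule: shuffles.induct)
  case (1 ys)
  then show ?case by (auto simp: inc_sides_def elim: sorted_wrt_mono_rel[rotated])
next
  case (2 xs)
  then show ?case by (auto simp: inc_sides_def elim: sorted_wrt_mono_rel[rotated])
next
  case (3 x xs y ys)
  then show ?case by (fastforce simp: inc_sides_def dest: set_shuffles)
qed

text \<open>Every descent goes from a value at least \<open>v\<close> to one below \<open>v\<close>,
  so a 321 cannot occur. In a 132 or 213 of the excluded kind, a value below \<open>v\<close> at a
  position below \<open>m\<close> precedes one at least \<open>v\<close>, against the second
  assumption.\<close>

lemma inc_sides_imp_cyclically_321_free:
  assumes "inc_sides v p"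
    and "\<And>i j. i < j \<Longrightarrow> j < length p \<Longrightarrow> i < m \<Longrightarrow> v \<le> p ! i \<or> p ! j < v"
  shows "cyclically_321_free m p"
proof -
  have inc: "p ! i < p ! j" if "i < j" "j < length p" "p ! i < v \<longleftrightarrow> p ! j < v" for i j
    using assms(1) that unfolding inc_sides_nth by blast
  show ?thesis
    unfolding cyclically_321_free_def
  proof (intro allI impI)
    fix i j l assume A: "i < j \<and> j < l \<and> l < length p"
    show "\<not> (p ! l < p ! j \<and> p ! j < p ! i) \<and>
         (i < m \<longrightarrow> \<not> (p ! i < p ! l \<and> p ! l < p ! j)) \<and>
         (j < m \<longrightarrow> \<not> (p ! j < p ! i \<and> p ! i < p ! l))"
      using inc[of i j] inc[of j l] inc[of i l] assms(2)[of i j] assms(2)[of i l]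
        assms(2)[of j l] A by linarith
  qed
qed

section \<open>Enumeration and count\<close>

lemma rot_avoiders_321_eq:
  assumes m: "1 \<le> m" "m < n"
  shows "rot_avoiders n (Suc m) [3, 2, 1] =
    (\<Union>v\<in>{1..Suc n - m}. (@) [v..<v + m] ` shuffles [1..<v] [v + m..<Suc n]) \<union>
    (\<lambda>v. [v..<Suc n] @ [1..<v]) ` {Suc n - m<..n}"
    (is "?S = ?A \<union> ?B")
proof (intro equalityI subsetI)
  fix p assume "p \<in> ?S"
  moreover from this have "p \<in> permutations_of_set {1..n}" by (simp add: rot_avoiders_def)
  ultimately show "p \<in> ?A \<union> ?B"
    using cyclically_321_free_cases[of p n m] rot_avoiders_321_iff[of p n m] m by blast
next
  fix p assume "p \<in> ?A \<union> ?B"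
  then show "p \<in> ?S"
  proof
    assume "p \<in> ?A"
    then obtain v s where v: "1 \<le> v" "v + m \<le> Suc n"
      and s: "s \<in> shuffles [1..<v] [v + m..<Suc n]" and p: "p = [v..<v + m] @ s"
      using m by auto
    have set_s: "set s = {1..<v} \<union> {v + m..<Suc n}" using set_shuffles[OF s] by (simp del: upt_Suc)
    have "distinct s" by (rule distinct_disjoint_shuffles[OF _ _ _ s]) auto
    then have perm: "p \<in> permutations_of_set {1..n}"
      using v set_s by (auto simp: p permutations_of_set_def)
    have "inc_sides v s" by (rule inc_sides_shuffles[OF s]) (auto simp del: upt_Suc)
    moreover have "inc_sides v [v..<v + m]"
      unfolding inc_sides_def by (rule sorted_wrt_mono_rel[OF _ sorted_wrt_upt]) auto
    ultimately have "inc_sides v p"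
      unfolding p inc_sides_def sorted_wrt_append using set_s by auto
    \<comment> \<open>All of the first \<open>m\<close> entries are at least
      \<open>v\<close>.\<close>
    then have "cyclically_321_free m p"
      by (rule inc_sides_imp_cyclically_321_free) (simp add: p nth_append)
    then show ?thesis using rot_avoiders_321_iff[OF perm m(2)] by simp
  next
    assume "p \<in> ?B"
    then obtain v where "v \<in> {Suc n - m<..n}" and p: "p = [v..<Suc n] @ [1..<v]"
      by blast
    then have v: "1 \<le> v" "v \<le> n" by auto
    have perm: "p \<in> permutations_of_set {1..n}"
      using v by (auto simp: p permutations_of_set_def)
    have "inc_sides v [v..<Suc n]" "inc_sides v [1..<v]"
      unfolding inc_sides_def by (rule sorted_wrt_mono_rel[OF _ sorted_wrt_upt]; auto)+
    then have "inc_sides v p"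
      unfolding p inc_sides_def sorted_wrt_append by auto
    \<comment> \<open>No value from \<open>v\<close> on follows a smaller one.\<close>
    then have "cyclically_321_free m p"
      by (rule inc_sides_imp_cyclically_321_free) (auto simp: p nth_append simp del: upt_Suc)
    then show ?thesis using rot_avoiders_321_iff[OF perm m(2)] by simp
  qed
qed

lemma card_rot_avoiders_321:
  assumes m: "1 \<le> m" "m < n"
  shows "card (rot_avoiders n (Suc m) [3, 2, 1]) = 2 ^ (n - m) + m - 1"
proof -
  define F where "F v = (@) [v..<v + m] ` shuffles [1..<v] [v + m..<Suc n]" for v
  define g where "g v = [v..<Suc n] @ [1..<v]" for v
  \<comment> \<open>The first entry recovers \<open>v\<close>, which makes all pieces disjoint and
    \<open>g\<close> injective on its range of \<open>v\<close>.\<close>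
  have hdF: "hd p = v" if "p \<in> F v" for p v
    using that m by (auto simp: F_def hd_append)
  have hdg: "hd (g v) = v" if "v \<le> n" for v
    using that by (simp add: g_def upt_conv_Cons del: upt_Suc)
  have cardF: "card (F v) = (n - m) choose (v - 1)" if "v \<in> {1..Suc n - m}" for v
  proof -
    have "card (F v) = card (shuffles [1..<v] [v + m..<Suc n])"
      unfolding F_def by (rule card_image) (auto simp: inj_on_def)
    also have "\<dots> = (v - 1 + (Suc n - (v + m))) choose (v - 1)"
      by (subst card_disjoint_shuffles) (auto simp del: upt_Suc)
    also have "v - 1 + (Suc n - (v + m)) = n - m" using that m by auto
    finally show ?thesis .
  qed
  have "card (\<Union>v\<in>{1..Suc n - m}. F v) = (\<Sum>v\<in>{1..Suc n - m}. card (F v))"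
    by (rule card_UN_disjoint) (auto simp: F_def[symmetric] dest: hdF, simp add: F_def)
  also have "\<dots> = (\<Sum>v\<in>{1..Suc n - m}. (n - m) choose (v - 1))"
    by (rule sum.cong) (simp_all add: cardF)
  \<comment> \<open>As \<open>v\<close> varies, the number \<open>w = v - 1\<close> of small values
    runs through a full binomial row.\<close>
  also have "\<dots> = (\<Sum>w\<le>n - m. (n - m) choose w)"
    by (rule sum.reindex_bij_witness[of _ Suc "\<lambda>v. v - 1"]) (use m in auto)
  finally have A: "card (\<Union>v\<in>{1..Suc n - m}. F v) = 2 ^ (n - m)"
    by (simp only: choose_row_sum)
  have "card (g ` {Suc n - m<..n}) = card {Suc n - m<..n}"
    by (rule card_image) (auto simp: inj_on_def dest: arg_cong[where f = hd] simp: hdg)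
  then have B: "card (g ` {Suc n - m<..n}) = m - 1" using m by auto
  have "(\<Union>v\<in>{1..Suc n - m}. F v) \<inter> g ` {Suc n - m<..n} = {}"
    using hdF hdg by fastforce
  moreover have "finite (F v)" for v by (simp add: F_def)
  ultimately have "card ((\<Union>v\<in>{1..Suc n - m}. F v) \<union> g ` {Suc n - m<..n}) = 2 ^ (n - m) + (m - 1)"
    using A B by (subst card_Un_disjoint) auto
  then show ?thesis
    using m unfolding rot_avoiders_321_eq[OF m] F_def g_def by simp
qed

theorem theorem3p1:
  fixes k n :: nat
  assumes "2 \<le> k" and "k \<le> n"
  shows "card (rot_avoiders n k [1, 2, 3]) = card (rot_avoiders n k [3, 2, 1]) \<and>
         card (rot_avoiders n k [3, 2, 1]) = 2 ^ (n - k + 1) + k - 2"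
proof -
  have "n - (k - 1) = n - k + 1" "Suc (k - 1) = k" using assms by auto
  then show ?thesis
    using card_rot_avoiders_123_eq_321 card_rot_avoiders_321[of "k - 1" n] assms
    by (simp add: numeral_2_eq_2)
qed

end
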